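(* Let $S\in\mathbb{R}^{L\times L}$ be irreducible and substochastic, with $\Omega=\{1,\dots,L\}$. The set of all coefficients $\mathbf{Q}_{ij}(S)$, $i,j\in\Omega$, $i\ne j$, can be computed from $S$ by inverting an $L\times L$ matrix and then performing additional operations of cost $O(L^2)$.
   Context: Cost is counted in elementary arithmetic operations on real numbers, and the constant in $O(L^2)$ does not depend on $S$ or $L$. A matrix is substochastic if its entries are nonnegative and every row sums to at most $1$. Definition of $\mathbf{Q}_{ij}(S)$: let $X^\omega$ be the discrete time Markov chain on $\Omega\cup\{\omega\}$, with $\omega\notin\Omega$ an additional absorbing state, whose transition matrix $S^\omega$ is given by $S^\omega_{kl}=S_{kl}$ for $k,l\in\Omega$, $S^\omega_{k\omega}=1-\sum_{l\in\Omega}S_{kl}$ for $k\in\Omega$, $S^\omega_{\omega k}=0$ for $k\in\Omega$, and $S^\omega_{\omega\omega}=1$. For a state $k$, let $\tau_k=\min\{s>0: X^\omega_s=k\}$ (with $\min\emptyset=\infty$). For $i,j\in\Omega$ with $i\neq j$, $$\mathbf{Q}_{ij}(S):=\mathbf{P}\left[\tau_j<\min\{\tau_i,\tau_\omega\}\,\middle|\,X^\omega_0=i\right].$$ *)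

theory Defs
  imports
    "HOL-Probability.Probability"
    "Jordan_Normal_Form.Gauss_Jordan_Elimination"
begin

section \<open>Irreducible and substochastic matrices\<close>

text \<open>The index set \<open>\<Omega>\<close> is \<open>{0..<L}\<close> with \<open>L = dim_row S\<close>.\<close>

definition substochastic :: "real mat \<Rightarrow> bool" where
  "substochastic S \<longleftrightarrow>
     (\<forall>k<dim_row S. \<forall>l<dim_row S. 0 \<le> S $$ (k, l)) \<and>
     (\<forall>k<dim_row S. (\<Sum>l<dim_row S. S $$ (k, l)) \<le> 1)"

text \<open>
  Every state can reach every state. The exponent 0 is allowed, which only matters for
  \<open>L = 1\<close>, where it makes the zero matrix irreducible.
\<close>

definition irreducible_matrix :: "real mat \<Rightarrow> bool" where
  "irreducible_matrix S \<longleftrightarrow>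
     (\<forall>k<dim_row S. \<forall>l<dim_row S. \<exists>n. 0 < (S ^\<^sub>m n) $$ (k, l))"

section \<open>Markov chains with a discrete state space\<close>

text \<open>
  The law on path space of the chain that starts in \<open>x\<close> and has transition probabilities
  \<open>K\<close>, obtained from the Ionescu-Tulcea theorem: the kernel that draws the state at time
  \<open>n\<close> is given the path \<open>h\<close> up to time \<open>n - 1\<close>.
\<close>

definition chain_kernel :: "('s \<Rightarrow> 's pmf) \<Rightarrow> 's \<Rightarrow> nat \<Rightarrow> (nat \<Rightarrow> 's) \<Rightarrow> 's measure" where
  "chain_kernel K x n h = measure_pmf (case n of 0 \<Rightarrow> return_pmf x | Suc m \<Rightarrow> K (h m))"

definition markov_chain :: "('s \<Rightarrow> 's pmf) \<Rightarrow> 's \<Rightarrow> (nat \<Rightarrow> 's) measure" where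
  "markov_chain K x =
     projective_family.lim UNIV (Ionescu_Tulcea.CI (chain_kernel K x) (\<lambda>_. count_space UNIV))
       (\<lambda>_. count_space UNIV)"

lemma Ionescu_Tulcea_chain_kernel:
  fixes K :: "'s::countable \<Rightarrow> 's pmf"
  shows "Ionescu_Tulcea (chain_kernel K x) (\<lambda>_. count_space UNIV)"
proof (rule Ionescu_Tulcea.intro)
  fix i
  show "chain_kernel K x i
          \<in> measurable (PiM {0..<i} (\<lambda>_. count_space UNIV)) (subprob_algebra (count_space UNIV))"
  proof (cases i)
    case 0
    then show ?thesis
      by (simp add: chain_kernel_def[abs_def] measure_pmf_in_subprob_algebra)
  next
    case (Suc m)
    have 1: "(\<lambda>h. h m) \<in> measurable (PiM {0..<i} (\<lambda>_. count_space UNIV)) (count_space (UNIV :: 's set))"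
      using Suc by (intro measurable_component_singleton) auto
    have 2: "(\<lambda>s. measure_pmf (K s)) \<in> measurable (count_space UNIV) (subprob_algebra (count_space UNIV))"
      by (simp add: measure_pmf_in_subprob_algebra)
    show ?thesis
      using measurable_compose[OF 1 2] Suc by (simp add: chain_kernel_def[abs_def])
  qed
next
  show "prob_space (chain_kernel K x i h)" for i h
    by (simp add: chain_kernel_def measure_pmf.prob_space_axioms)
qed

lemma sets_markov_chain:
  fixes K :: "'s::countable \<Rightarrow> 's pmf"
  shows "sets (markov_chain K x) = sets (PiM UNIV (\<lambda>_. count_space UNIV))"
proof -
  interpret Ionescu_Tulcea "chain_kernel K x" "\<lambda>_. count_space UNIV"
    by (rule Ionescu_Tulcea_chain_kernel)
  show ?thesis
    unfolding markov_chain_def by (rule PF.sets_lim)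
qed

lemma space_markov_chain:
  fixes K :: "'s::countable \<Rightarrow> 's pmf"
  shows "space (markov_chain K x) = UNIV"
  by (subst sets_eq_imp_space_eq[OF sets_markov_chain]) (auto simp: space_PiM)

lemma emeasure_chain_C:
  fixes K :: "'s::countable \<Rightarrow> 's pmf"
  shows "emeasure (Ionescu_Tulcea.C (chain_kernel K x) (\<lambda>_. count_space UNIV) 0 (Suc n) (\<lambda>_. undefined))
            {restrict y {0..<Suc n}} =
         ennreal ((if y 0 = x then 1 else 0) * (\<Prod>m<n. pmf (K (y m)) (y (Suc m))))"
proof -
  interpret Ionescu_Tulcea "chain_kernel K x" "\<lambda>_. count_space UNIV"
    by (rule Ionescu_Tulcea_chain_kernel)
  let ?P = "\<lambda>n. PiM {0..<n} (\<lambda>_. count_space (UNIV :: 's set))"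
  have sing: "{restrict y {0..<n}} \<in> sets (?P n)" for n
  proof -
    have "{restrict y {0..<n}} = PiE {0..<n} (\<lambda>m. {y m})"
      by (auto simp: PiE_def Pi_iff extensional_def fun_eq_iff restrict_def)
    also have "\<dots> \<in> sets (?P n)"
      by (intro sets_PiM_I_finite) auto
    finally show ?thesis .
  qed
  have upd: "fun_upd h n -` {restrict y {0..<Suc n}} = (if h = restrict y {0..<n} then {y n} else {})"
    if "h \<in> space (?P n)" for h n
  proof -
    have hn: "h n = undefined"
      using that by (auto simp: space_PiM PiE_def extensional_def)
    have "restrict y {0..<Suc n} = (restrict y {0..<n})(n := y n)"
      by (auto simp: fun_eq_iff)
    moreover have "h(n := z) = (restrict y {0..<n})(n := y n) \<longleftrightarrow> z = y n \<and> h = restrict y {0..<n}" for z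
    proof
      assume eq: "h(n := z) = (restrict y {0..<n})(n := y n)"
      show "z = y n \<and> h = restrict y {0..<n}"
      proof (intro conjI ext)
        show "z = y n"
          using fun_cong[OF eq, of n] by simp
        show "h m = restrict y {0..<n} m" for m
          using fun_cong[OF eq, of m] hn by (cases "m = n") auto
      qed
    qed auto
    ultimately show ?thesis
      by auto
  qed
  have eP: "emeasure (eP n h) {restrict y {0..<Suc n}} =
      emeasure (chain_kernel K x n h) {y n} * indicator {restrict y {0..<n}} h"
    if "h \<in> space (?P n)" for h n
    using that emeasure_eP[OF that sing] upd[OF that] by simp
  have rest: "restrict y {0..<n} \<in> space (?P n)" for n
    by (auto simp: space_PiM)
  have step: "emeasure (C 0 (Suc n) (\<lambda>_. undefined)) {restrict y {0..<Suc n}} =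
      emeasure (chain_kernel K x n (restrict y {0..<n})) {y n} *
      emeasure (C 0 n (\<lambda>_. undefined)) {restrict y {0..<n}}" for n
  proof -
    have u: "(\<lambda>_. undefined) \<in> space (?P 0)"
      by (simp add: space_PiM PiE_def extensional_def)
    have sC: "sets (C 0 n (\<lambda>_. undefined)) = sets (?P n)"
      using sets_C[OF u, of n] by simp
    have spC: "space (C 0 n (\<lambda>_. undefined)) = space (?P n)"
      by (rule sets_eq_imp_space_eq[OF sC])
    have "emeasure (C 0 (Suc n) (\<lambda>_. undefined)) {restrict y {0..<Suc n}} =
        (\<integral>\<^sup>+h. emeasure (eP n h) {restrict y {0..<Suc n}} \<partial>C 0 n (\<lambda>_. undefined))"
      unfolding C.simps add_0
      using measurable_eP[of n] sing[of "Suc n"]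
      by (intro emeasure_bind) (auto simp: spC intro: rest cong: measurable_cong_sets[OF sC refl])
    also have "\<dots> = (\<integral>\<^sup>+h. emeasure (chain_kernel K x n (restrict y {0..<n})) {y n} *
        indicator {restrict y {0..<n}} h \<partial>C 0 n (\<lambda>_. undefined))"
      by (intro nn_integral_cong) (auto simp: spC eP split: split_indicator)
    also have "\<dots> = emeasure (chain_kernel K x n (restrict y {0..<n})) {y n} *
        emeasure (C 0 n (\<lambda>_. undefined)) {restrict y {0..<n}}"
      using sing[of n] by (intro nn_integral_cmult_indicator) (simp add: sC)
    finally show ?thesis .
  qed
  show ?thesis
  proof (induction n)
    case 0
    have "emeasure (C 0 0 (\<lambda>_. undefined)) {restrict y {0..<0}} = 1"
      using sing[of 0] by (simp add: restrict_def indicator_def)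
    then show ?case
      by (subst step)
         (auto simp: chain_kernel_def emeasure_pmf_single)
  next
    case (Suc n)
    show ?case
      by (subst step)
         (simp add: Suc.IH chain_kernel_def emeasure_pmf_single ennreal_mult'[symmetric] prod_nonneg
           mult_ac del: C.simps)
  qed
qed

text \<open>The finite-dimensional distributions are those of the Markov chain.\<close>

lemma measure_markov_chain_cylinder:
  fixes K :: "'s::countable \<Rightarrow> 's pmf"
  shows "measure (markov_chain K x) {X. \<forall>m\<le>n. X m = y m} =
           (if y 0 = x then 1 else 0) * (\<Prod>m<n. pmf (K (y m)) (y (Suc m)))"
proof -
  interpret Ionescu_Tulcea "chain_kernel K x" "\<lambda>_. count_space UNIV"
    by (rule Ionescu_Tulcea_chain_kernel)
  let ?A = "{restrict y {0..<Suc n}}"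
  have A: "?A = PiE {0..<Suc n} (\<lambda>m. {y m})"
    by (auto simp: PiE_def Pi_iff extensional_def fun_eq_iff restrict_def)
  have sA: "?A \<in> sets (PiM {0..<Suc n} (\<lambda>_. count_space UNIV))"
    unfolding A by (intro sets_PiM_I_finite) auto
  have "PF.emb UNIV {0..<Suc n} ?A = {X. \<forall>m\<le>n. X m = y m}"
    unfolding A
    by (subst prod_emb_PiE) (fastforce simp: PiE_iff less_Suc_eq_le split: if_splits)+
  moreover have "emeasure PF.lim (PF.emb UNIV {0..<Suc n} ?A) = emeasure (C 0 (Suc n) (\<lambda>_. undefined)) ?A"
    using sA by (subst lim) (simp_all add: emeasure_CI[of _ "Suc n"] prod_emb_id
        sets.sets_into_space del: C.simps)
  ultimately have "emeasure (markov_chain K x) {X. \<forall>m\<le>n. X m = y m} =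
      ennreal ((if y 0 = x then 1 else 0) * (\<Prod>m<n. pmf (K (y m)) (y (Suc m))))"
    unfolding markov_chain_def using emeasure_chain_C[of K x n y] by (simp del: C.simps)
  then show ?thesis
    unfolding measure_def by (simp add: prod_nonneg)
qed

section \<open>The coefficients\<close>

text \<open>
  The state \<open>k \<in> \<Omega>\<close> is \<open>Some k\<close>, the absorbing state \<open>\<omega>\<close> is \<open>None\<close>. The numbers
  \<open>k \<ge> L\<close> are not states: they get probability 0.
\<close>

fun absorbing_extension :: "real mat \<Rightarrow> nat option \<Rightarrow> nat option \<Rightarrow> real" where
  "absorbing_extension S (Some k) (Some l) = (if l < dim_row S then S $$ (k, l) else 0)"
| "absorbing_extension S (Some k) None = 1 - (\<Sum>l<dim_row S. S $$ (k, l))"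
| "absorbing_extension S None (Some l) = 0"
| "absorbing_extension S None None = 1"

definition transition :: "real mat \<Rightarrow> nat option \<Rightarrow> nat option pmf" where
  "transition S x = embed_pmf (absorbing_extension S x)"

lemma pmf_transition:
  assumes "substochastic S" and "\<And>k. x = Some k \<Longrightarrow> k < dim_row S"
  shows "pmf (transition S x) y = absorbing_extension S x y"
  unfolding transition_def
proof (rule pmf_embed_pmf)
  show nonneg: "0 \<le> absorbing_extension S x z" for z
    using assms by (cases x; cases z) (auto simp: substochastic_def)
  let ?D = "insert None (Some ` {..<dim_row S})"
  have "(\<integral>\<^sup>+z. ennreal (absorbing_extension S x z) \<partial>count_space UNIV) =
      (\<integral>\<^sup>+z. ennreal (absorbing_extension S x z) \<partial>count_space ?D)"
  proof (rule nn_integral_count_space_eq)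
    fix z
    assume "z \<in> UNIV - ?D"
    then show "ennreal (absorbing_extension S x z) = 0"
      by (cases x; cases z) auto
  qed auto
  also have "\<dots> = (\<Sum>z\<in>?D. ennreal (absorbing_extension S x z))"
    by (rule nn_integral_count_space_finite) simp
  also have "\<dots> = ennreal (\<Sum>z\<in>?D. absorbing_extension S x z)"
    by (rule sum_ennreal) (rule nonneg)
  also have "(\<Sum>z\<in>?D. absorbing_extension S x z) = 1"
    by (cases x) (auto simp: sum.reindex)
  finally show "(\<integral>\<^sup>+z. ennreal (absorbing_extension S x z) \<partial>count_space UNIV) = 1"
    by simp
qed

definition hitting_time :: "(nat \<Rightarrow> 's) \<Rightarrow> 's \<Rightarrow> enat" where
  "hitting_time X k = Inf {enat s |s. 0 < s \<and> X s = k}"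

definition Q :: "real mat \<Rightarrow> nat \<Rightarrow> nat \<Rightarrow> real" where
  "Q S i j =
     \<P>(X in markov_chain (transition S) (Some i).
        hitting_time X (Some j) < min (hitting_time X (Some i)) (hitting_time X None))"

section \<open>Arithmetic programs on matrices\<close>

text \<open>
  A program is a fixed text that does not depend on \<open>L\<close>. It works on \<open>L \<times> L\<close> arrays of
  real numbers, numbered by \<open>nat\<close>, and controls its loops by index variables, numbered
  by \<open>nat\<close>, with values in \<open>{0..<L}\<close>. \<open>Entry a u v\<close> and \<open>Assign a u v t\<close> refer to the entry of
  array \<open>a\<close> whose row and column are the values of the index variables \<open>u\<close> and \<open>v\<close>. Index
  variables not bound by a loop are 0. Control flow depends on index variables only, never
  on real data; the only real constants are 0 and 1.
\<close>

datatype rexp =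
    Zero
  | One
  | Entry nat nat nat
  | Plus rexp rexp
  | Minus rexp rexp
  | Times rexp rexp
  | Divide rexp rexp

datatype com =
    Skip
  | Assign nat nat nat rexp
  | Seq com com
  | IfEq nat nat com com
  | For nat com

type_synonym indices = "nat \<Rightarrow> nat"
type_synonym arrays = "nat \<Rightarrow> nat \<Rightarrow> nat \<Rightarrow> real"

text \<open>Division by zero makes the program fail, which is the value \<open>None\<close>.\<close>

fun eval :: "indices \<Rightarrow> arrays \<Rightarrow> rexp \<Rightarrow> real option" where
  "eval e A Zero = Some 0"
| "eval e A One = Some 1"
| "eval e A (Entry a u v) = Some (A a (e u) (e v))"
| "eval e A (Plus s t) =
     Option.bind (eval e A s) (\<lambda>x. Option.bind (eval e A t) (\<lambda>y. Some (x + y)))"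
| "eval e A (Minus s t) =
     Option.bind (eval e A s) (\<lambda>x. Option.bind (eval e A t) (\<lambda>y. Some (x - y)))"
| "eval e A (Times s t) =
     Option.bind (eval e A s) (\<lambda>x. Option.bind (eval e A t) (\<lambda>y. Some (x * y)))"
| "eval e A (Divide s t) =
     Option.bind (eval e A s) (\<lambda>x. Option.bind (eval e A t)
       (\<lambda>y. if y = 0 then None else Some (x / y)))"

fun operations :: "rexp \<Rightarrow> nat" where
  "operations Zero = 0"
| "operations One = 0"
| "operations (Entry a u v) = 0"
| "operations (Plus s t) = operations s + operations t + 1"
| "operations (Minus s t) = operations s + operations t + 1"
| "operations (Times s t) = operations s + operations t + 1"
| "operations (Divide s t) = operations s + operations t + 1"

definition update_entry :: "arrays \<Rightarrow> nat \<Rightarrow> nat \<Rightarrow> nat \<Rightarrow> real \<Rightarrow> arrays" where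
  "update_entry A a k l x = A(a := (A a)(k := (A a k)(l := x)))"

text \<open>
  The state consists of the arrays and the number of arithmetic operations executed so far.
\<close>

primrec exec :: "nat \<Rightarrow> com \<Rightarrow> indices \<Rightarrow> arrays \<times> nat \<Rightarrow> (arrays \<times> nat) option" where
  "exec L Skip e p = Some p"
| "exec L (Assign a u v t) e p =
     map_option (\<lambda>x. (update_entry (fst p) a (e u) (e v) x, snd p + operations t))
       (eval e (fst p) t)"
| "exec L (Seq c d) e p = Option.bind (exec L c e p) (exec L d e)"
| "exec L (IfEq u v c d) e p = (if e u = e v then exec L c e p else exec L d e p)"
| "exec L (For u c) e p =
     fold (\<lambda>k r. Option.bind r (exec L c (e(u := k)))) [0..<L] (Some p)"

definition array_of_mat :: "nat \<Rightarrow> real mat \<Rightarrow> nat \<Rightarrow> nat \<Rightarrow> real" where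
  "array_of_mat L B k l = (if k < L \<and> l < L then B $$ (k, l) else 0)"

definition mat_of_array :: "nat \<Rightarrow> (nat \<Rightarrow> nat \<Rightarrow> real) \<Rightarrow> real mat" where
  "mat_of_array L f = mat L L (\<lambda>(k, l). f k l)"

text \<open>
  An algorithm that performs exactly one inversion. The input \<open>S\<close> is array 0, all other
  arrays are initially 0. The program \<open>prep\<close> leaves the matrix to be inverted in array 1,
  its inverse is written to array 2, and \<open>post\<close> then leaves the output in array 3. The
  algorithm fails if the matrix is not invertible. The second component of the result is
  the number of arithmetic operations in \<open>prep\<close> and \<open>post\<close> together.
\<close>

definition run_with_inversion :: "nat \<Rightarrow> com \<Rightarrow> com \<Rightarrow> real mat \<Rightarrow> (real mat \<times> nat) option" where
  "run_with_inversion L prep post S =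
     Option.bind (exec L prep (\<lambda>_. 0) ((\<lambda>_ _ _. 0)(0 := array_of_mat L S), 0)) (\<lambda>(A, n).
     Option.bind (mat_inverse (mat_of_array L (A 1))) (\<lambda>B.
     Option.bind (exec L post (\<lambda>_. 0) (A(2 := array_of_mat L B), n)) (\<lambda>(A', n').
     Some (mat_of_array L (A' 3), n'))))"

end

theory Submission
  imports Defs "Jordan_Normal_Form.Determinant"
begin

text \<open>
  Killing the chain when it leaves state \<open>0\<close> turns \<open>S\<close> into a matrix \<open>S'\<close> whose row \<open>0\<close> is zero, and
  \<open>I - S'\<close> is invertible for every irreducible substochastic \<open>S\<close> (lemma \<open>mat_inverse_cut_matrix\<close>). This
  matters because \<open>I - S\<close> itself is singular precisely when \<open>S\<close> is stochastic, and a program whose control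
  flow ignores the data cannot distinguish the two cases. The one inversion is spent on
  \<open>B = (I - S')\<^sup>-\<^sup>1\<close>.

  When \<open>I - S\<close> has an inverse \<open>N\<close>, the coefficient is
  \<open>N\<^sub>i\<^sub>j / (N\<^sub>i\<^sub>i * N\<^sub>j\<^sub>j - N\<^sub>i\<^sub>j * N\<^sub>j\<^sub>i)\<close>. As \<open>I - S\<close> and \<open>I - S'\<close> differ in one row, \<open>N\<close> is a rank-one update of
  \<open>B\<close>. With \<open>w = s B\<close>, where \<open>s\<close> is row \<open>0\<close> of \<open>S\<close>, and \<open>d = 1 - w\<^sub>0\<close>, the factors \<open>1 / d\<close> of this update
  cancel in the quotient, which leaves a formula that has no singularity at \<open>d = 0\<close>, namely
  \<open>(d B\<^sub>i\<^sub>j + B\<^sub>i\<^sub>0 w\<^sub>j) / ((d B\<^sub>i\<^sub>i + B\<^sub>i\<^sub>0 w\<^sub>i) B\<^sub>j\<^sub>j - (d B\<^sub>i\<^sub>j + B\<^sub>i\<^sub>0 w\<^sub>j) B\<^sub>j\<^sub>i + (B\<^sub>i\<^sub>i w\<^sub>j - B\<^sub>i\<^sub>j w\<^sub>i) B\<^sub>j\<^sub>0)\<close>.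
  The vector \<open>w\<close> costs \<open>O(L\<^sup>2)\<close> operations, and then each coefficient costs \<open>O(1)\<close>.

  The proof treats all values of \<open>d\<close> together and never uses \<open>N\<close>. First-step analysis
  (\<open>first_step_equation\<close>) gives a linear system for the probabilities of entering \<open>j\<close> before \<open>i\<close> and
  \<open>\<omega>\<close>, one for each starting state. Solving it through \<open>B\<close> leaves three equations in three unknowns, one
  of them \<open>\<^bold>Q\<^sub>i\<^sub>j(S)\<close>, and Cramer's rule gives the quotient (\<open>first_step_solution_eq_quotient\<close>). That the
  denominator, the determinant of the three equations, is not zero follows from a maximum principle
  for irreducible matrices (\<open>maximum_principle\<close>); the same principle yields the invertibility of \<open>I - S'\<close>.
\<close>

section \<open>First-step analysis of a countable Markov chain\<close>

lemma prob_space_markov_chain: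
  fixes K :: "'s::countable \<Rightarrow> 's pmf"
  shows "prob_space (markov_chain K x)"
proof -
  interpret Ionescu_Tulcea "chain_kernel K x" "\<lambda>_. count_space UNIV"
    by (rule Ionescu_Tulcea_chain_kernel)
  let ?\<Omega> = "space (PiM {0::nat} (\<lambda>_. count_space (UNIV :: 's set)))"
  have "emeasure PF.lim (PF.emb UNIV {0} ?\<Omega>) = emeasure (CI {0}) ?\<Omega>"
    by (rule lim) auto
  also have "\<dots> = 1"
    using prob_space.emeasure_space_1[OF PF.prob_space_P[of "{0}"]] by (simp add: PF.space_P)
  also have "PF.emb UNIV {0} ?\<Omega> = space PF.lim"
    by (auto simp: prod_emb_def space_PiM PF.space_lim)
  finally show ?thesis
    unfolding markov_chain_def by (rule prob_spaceI)
qed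

lemma measurable_coordinate:
  fixes K :: "'s::countable \<Rightarrow> 's pmf"
  shows "(\<lambda>X. X n) \<in> measurable (markov_chain K x) (count_space UNIV)"
  by (subst measurable_cong_sets[OF sets_markov_chain refl])
     (rule measurable_component_singleton, simp)

lemma sets_coordinate_event:
  fixes K :: "'s::countable \<Rightarrow> 's pmf"
  shows "{X. X n \<in> A} \<in> sets (markov_chain K x)"
  using measurable_sets[OF measurable_coordinate[of n K x], of A]
  by (simp add: space_markov_chain vimage_def)

corollary sets_coordinate_eq:
  fixes K :: "'s::countable \<Rightarrow> 's pmf"
  shows "{X. X n = b} \<in> sets (markov_chain K x)"
  using sets_coordinate_event[of n "{b}" K x] by simp

lemma all_less_Suc_shift: "(\<forall>m<Suc n. P m) \<longleftrightarrow> P 0 \<and> (\<forall>m<n. P (Suc m))"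
  by (auto simp: less_Suc_eq_0_disj)

text \<open>
  The probability, started in \<open>x\<close>, that the states at times \<open>1, \<dots>, n\<close> lie in \<open>F\<close> and the state at
  time \<open>n + 1\<close> is \<open>b\<close>.
\<close>

primrec passage :: "('s \<Rightarrow> 's pmf) \<Rightarrow> 's set \<Rightarrow> 's \<Rightarrow> nat \<Rightarrow> 's \<Rightarrow> ennreal" where
  "passage K F b 0 x = ennreal (pmf (K x) b)"
| "passage K F b (Suc n) x = (\<integral>\<^sup>+z\<in>F. passage K F b n z \<partial>measure_pmf (K x))"

text \<open>
  The Markov property in the only form that is used. Prescribing a whole initial path, rather than
  the present state alone, makes the induction on \<open>n\<close> immediate: splitting over the next state gives
  cylinders again, whose measure is the product formula.
\<close>

lemma emeasure_cylinder_passage: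
  fixes K :: "'s::countable \<Rightarrow> 's pmf"
  shows "emeasure (markov_chain K x)
           {X. (\<forall>m\<le>p. X m = y m) \<and> (\<forall>m<n. X (Suc (p + m)) \<in> F) \<and> X (Suc (p + n)) = b} =
         emeasure (markov_chain K x) {X. \<forall>m\<le>p. X m = y m} * passage K F b n (y p)"
proof -
  interpret M: prob_space "markov_chain K x"
    by (rule prob_space_markov_chain)
  have cylinder: "emeasure (markov_chain K x) {X. \<forall>m\<le>Suc p. X m = (y(Suc p := z)) m} =
      emeasure (markov_chain K x) {X. \<forall>m\<le>p. X m = y m} * ennreal (pmf (K (y p)) z)" for p y z
    unfolding M.emeasure_eq_measure measure_markov_chain_cylinder
    by (subst ennreal_mult[symmetric]) (auto simp: prod_nonneg)
  have ext: "{X. (\<forall>m\<le>Suc p. X m = (y(Suc p := z)) m) \<and> P X} =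
      {X. (\<forall>m\<le>p. X m = y m) \<and> X (Suc p) = z \<and> P X}" for p y z P
    by (auto simp: le_Suc_eq)
  show ?thesis
  proof (induction n arbitrary: p y)
    case 0
    show ?case
      using cylinder[of p y b] ext[of p y b "\<lambda>_. True"] by simp
  next
    case (Suc n)
    let ?E = "\<lambda>z. {X. (\<forall>m\<le>Suc p. X m = (y(Suc p := z)) m) \<and>
        (\<forall>m<n. X (Suc (Suc p + m)) \<in> F) \<and> X (Suc (Suc p + n)) = b}"
    have sets: "?E z \<in> sets (markov_chain K x)" for z
    proof -
      have "?E z = (\<Inter>m\<in>{..Suc p}. {X. X m \<in> {(y(Suc p := z)) m}}) \<inter>
          (\<Inter>m\<in>{..<n}. {X. X (Suc (Suc p + m)) \<in> F}) \<inter> {X. X (Suc (Suc p + n)) \<in> {b}}"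
        by auto
      also have "\<dots> \<in> sets (markov_chain K x)"
        by (cases "n = 0")
           (auto simp: lessThan_empty_iff intro!: sets.Int sets.finite_INT sets_coordinate_event sets_coordinate_eq simp del: fun_upd_apply)
      finally show ?thesis .
    qed
    have "{X. (\<forall>m\<le>p. X m = y m) \<and> (\<forall>m<Suc n. X (Suc (p + m)) \<in> F) \<and> X (Suc (p + Suc n)) = b} =
        (\<Union>z\<in>F. ?E z)"
      unfolding ext all_less_Suc_shift by auto
    then have "emeasure (markov_chain K x)
        {X. (\<forall>m\<le>p. X m = y m) \<and> (\<forall>m<Suc n. X (Suc (p + m)) \<in> F) \<and> X (Suc (p + Suc n)) = b} =
        (\<integral>\<^sup>+z. emeasure (markov_chain K x) (?E z) \<partial>count_space F)"
      using sets by (simp only:)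
        (intro emeasure_UN_countable, auto simp: disjoint_family_on_def)
    also have "\<dots> = (\<integral>\<^sup>+z. emeasure (markov_chain K x) {X. \<forall>m\<le>p. X m = y m} *
        (ennreal (pmf (K (y p)) z) * passage K F b n z) \<partial>count_space F)"
      unfolding Suc.IH cylinder by (simp add: mult.assoc)
    also have "\<dots> = emeasure (markov_chain K x) {X. \<forall>m\<le>p. X m = y m} *
        (\<integral>\<^sup>+z. ennreal (pmf (K (y p)) z) * passage K F b n z \<partial>count_space F)"
      by (rule nn_integral_cmult) simp
    also have "(\<integral>\<^sup>+z. ennreal (pmf (K (y p)) z) * passage K F b n z \<partial>count_space F) =
        passage K F b (Suc n) (y p)"
      by (simp add: nn_integral_measure_pmf nn_integral_count_space_indicator mult.assoc)
    finally show ?case .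
  qed
qed

lemma emeasure_markov_chain_start:
  fixes K :: "'s::countable \<Rightarrow> 's pmf"
  assumes A: "A \<in> sets (markov_chain K x)"
  shows "emeasure (markov_chain K x) {X \<in> A. X 0 = x} = emeasure (markov_chain K x) A"
proof -
  interpret M: prob_space "markov_chain K x"
    by (rule prob_space_markov_chain)
  have "M.prob {X. X 0 = x} = 1"
    using measure_markov_chain_cylinder[of K x 0 "\<lambda>_. x"] by simp
  then have "AE X in markov_chain K x. X 0 = x"
    using M.prob_eq_1[of "{X. X 0 = x}"] sets_coordinate_event[of 0 "{x}" K x] by simp
  moreover have "{X \<in> A. X 0 = x} = A \<inter> {X. X 0 \<in> {x}}"
    by auto
  ultimately show ?thesis
    using A sets_coordinate_event[of 0 "{x}" K x] by (intro emeasure_eq_AE) auto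
qed

definition enters_via :: "'s set \<Rightarrow> 's \<Rightarrow> (nat \<Rightarrow> 's) set" where
  "enters_via F b = {X. \<exists>n. (\<forall>m<n. X (Suc m) \<in> F) \<and> X (Suc n) = b}"

text \<open>
  Because \<open>b\<close> is not in \<open>F\<close>, the time of the entry is determined by the path, so the probability is the
  sum over that time. The term of time \<open>1\<close> is the transition probability to \<open>b\<close>, the later ones are
  averages over the first state visited.
\<close>

theorem first_step_equation:
  fixes K :: "'s::countable \<Rightarrow> 's pmf"
  assumes b: "b \<notin> F"
  shows "emeasure (markov_chain K x) (enters_via F b) =
    ennreal (pmf (K x) b) + (\<integral>\<^sup>+z\<in>F. emeasure (markov_chain K z) (enters_via F b) \<partial>measure_pmf (K x))"
proof -
  let ?E = "\<lambda>n. {X. (\<forall>m<n. X (Suc m) \<in> F) \<and> X (Suc n) = b}"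
  have sets: "?E n \<in> sets (markov_chain K x)" for n x
  proof -
    have "?E n = (\<Inter>m\<in>{..<n}. {X. X (Suc m) \<in> F}) \<inter> {X. X (Suc n) \<in> {b}}"
      by auto
    also have "\<dots> \<in> sets (markov_chain K x)"
      by (cases "n = 0")
         (auto simp: lessThan_empty_iff intro!: sets.Int sets.finite_INT sets_coordinate_event sets_coordinate_eq)
    finally show ?thesis .
  qed
  have disj: "disjoint_family ?E"
    unfolding disjoint_family_on_def
  proof safe
    fix m n X
    assume "m \<noteq> n" "\<forall>k<m. X (Suc k) \<in> F" "\<forall>k<n. X (Suc k) \<in> F" "X (Suc n) = X (Suc m)" "b = X (Suc m)"
    with b show "X \<in> {}"
      by (metis nat_neq_iff)
  qed
  have Esum: "emeasure (markov_chain K x) (enters_via F b) = (\<Sum>n. passage K F b n x)" for x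
  proof -
    have E: "emeasure (markov_chain K x) (?E n) = passage K F b n x" for n
    proof -
      interpret M: prob_space "markov_chain K x"
        by (rule prob_space_markov_chain)
      have "emeasure (markov_chain K x) (?E n) = emeasure (markov_chain K x) {X \<in> ?E n. X 0 = x}"
        by (rule emeasure_markov_chain_start[symmetric, OF sets])
      also have "{X \<in> ?E n. X 0 = x} =
          {X. (\<forall>m\<le>0. X m = x) \<and> (\<forall>m<n. X (Suc (0 + m)) \<in> F) \<and> X (Suc (0 + n)) = b}"
        by auto
      also have "emeasure (markov_chain K x) \<dots> = passage K F b n x"
        using measure_markov_chain_cylinder[of K x 0 "\<lambda>_. x"]
        by (subst emeasure_cylinder_passage[where y = "\<lambda>_. x"]) (simp add: M.emeasure_eq_measure)
      finally show ?thesis .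
    qed
    have "enters_via F b = (\<Union>n. ?E n)"
      by (auto simp: enters_via_def)
    then show ?thesis
      using suminf_emeasure[OF _ disj, of "markov_chain K x"] sets by (simp add: E image_subset_iff)
  qed
  have "(\<Sum>n. passage K F b n x) = passage K F b 0 x + (\<Sum>n. passage K F b (Suc n) x)"
    using suminf_offset[of "\<lambda>n. passage K F b n x" 1] by (simp add: summableI)
  also have "(\<Sum>n. passage K F b (Suc n) x) = (\<integral>\<^sup>+z\<in>F. (\<Sum>n. passage K F b n z) \<partial>measure_pmf (K x))"
    by (simp add: nn_integral_suminf[symmetric] ennreal_suminf_multc)
  finally show ?thesis
    by (simp add: Esum)
qed

section \<open>The first-step equations of the coefficients\<close>

lemma hitting_time_less_iff: "hitting_time X k < t \<longleftrightarrow> (\<exists>s>0. X s = k \<and> enat s < t)"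
  unfolding hitting_time_def Inf_less_iff by auto

lemma less_hitting_time_iff: "enat s < hitting_time X k \<longleftrightarrow> (\<forall>r>0. r \<le> s \<longrightarrow> X r \<noteq> k)"
proof -
  have "hitting_time X k < enat (Suc s) \<longleftrightarrow> (\<exists>r>0. X r = k \<and> r \<le> s)"
    by (simp add: hitting_time_less_iff less_Suc_eq_le)
  moreover have "hitting_time X k < enat (Suc s) \<longleftrightarrow> hitting_time X k \<le> enat s"
    by (cases "hitting_time X k") auto
  ultimately have "hitting_time X k \<le> enat s \<longleftrightarrow> (\<exists>r>0. X r = k \<and> r \<le> s)"
    by simp
  then show ?thesis
    using linorder_not_le[of "hitting_time X k" "enat s"] by blast
qed

lemma hits_first_iff_enters_via:
  assumes "i \<noteq> j"
  shows "hitting_time X (Some j) < min (hitting_time X (Some i)) (hitting_time X None) \<longleftrightarrow>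
    X \<in> enters_via (- {Some i, Some j, None}) (Some j)"
proof
  assume "hitting_time X (Some j) < min (hitting_time X (Some i)) (hitting_time X None)"
  then obtain s where "s > 0" "X s = Some j"
    and avoid: "\<And>r. 0 < r \<Longrightarrow> r \<le> s \<Longrightarrow> X r \<noteq> Some i \<and> X r \<noteq> None"
    unfolding hitting_time_less_iff by (auto simp: less_hitting_time_iff)
  then have ex: "\<exists>n. Suc n \<le> s \<and> X (Suc n) = Some j"
    by (intro exI[of _ "s - 1"]) simp
  define n where "n = (LEAST n. Suc n \<le> s \<and> X (Suc n) = Some j)"
  have n: "Suc n \<le> s" "X (Suc n) = Some j"
    using LeastI_ex[OF ex] by (simp_all add: n_def)
  have "X (Suc m) \<noteq> Some j" if "m < n" for m
    using not_less_Least[OF that[unfolded n_def]] that n by auto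
  then show "X \<in> enters_via (- {Some i, Some j, None}) (Some j)"
    unfolding enters_via_def using n avoid by (intro CollectI exI[of _ n]) auto
next
  assume "X \<in> enters_via (- {Some i, Some j, None}) (Some j)"
  then obtain n where n: "X (Suc n) = Some j" "\<And>m. m < n \<Longrightarrow> X (Suc m) \<notin> {Some i, Some j, None}"
    by (auto simp: enters_via_def)
  have "X r \<noteq> Some i \<and> X r \<noteq> None" if "0 < r" "r \<le> Suc n" for r
  proof (cases "r = Suc n")
    case False
    then show ?thesis
      using n(2)[of "r - 1"] that by simp
  qed (use n(1) assms in simp)
  then have "enat (Suc n) < min (hitting_time X (Some i)) (hitting_time X None)"
    unfolding min_less_iff_conj less_hitting_time_iff by blast
  then show "hitting_time X (Some j) < min (hitting_time X (Some i)) (hitting_time X None)"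
    unfolding hitting_time_less_iff using n(1) by blast
qed

text \<open>
  The start \<open>k\<close> may be any state, because the first-step equations couple all of them. The set of
  states to pass through contains the options \<open>Some l\<close> with \<open>l \<ge> dim_row S\<close>, which
  have transition probability \<open>0\<close>.
\<close>

definition prob_first_entry :: "real mat \<Rightarrow> nat \<Rightarrow> nat \<Rightarrow> nat \<Rightarrow> real" where
  "prob_first_entry S i j k = measure (markov_chain (transition S) (Some k)) (enters_via (- {Some i, Some j, None}) (Some j))"

lemma Q_eq_prob_first_entry: "i \<noteq> j \<Longrightarrow> Q S i j = prob_first_entry S i j i"
  by (simp add: Q_def prob_first_entry_def hits_first_iff_enters_via space_markov_chain del: min_less_iff_conj)

lemma prob_first_entry_nonneg: "0 \<le> prob_first_entry S i j k"
  by (simp add: prob_first_entry_def)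

lemma prob_first_entry_first_step:
  assumes S: "substochastic S" and k: "k < dim_row S" and j: "j < dim_row S"
  shows "prob_first_entry S i j k = S $$ (k, j) + (\<Sum>l\<in>{..<dim_row S} - {i, j}. S $$ (k, l) * prob_first_entry S i j l)"
proof -
  let ?R = "{..<dim_row S} - {i, j}"
  let ?F = "- {Some i, Some j, None}"
  have em: "emeasure (markov_chain (transition S) (Some l)) (enters_via ?F (Some j)) = ennreal (prob_first_entry S i j l)" for l
    unfolding prob_first_entry_def
    by (rule finite_measure.emeasure_eq_measure, rule prob_space.finite_measure, rule prob_space_markov_chain)
  have pmf: "pmf (transition S (Some k)) z = absorbing_extension S (Some k) z" for z
    by (rule pmf_transition[OF S]) (use k in simp)
  have nonneg: "0 \<le> S $$ (k, l)" if "l < dim_row S" for l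
    using S k that by (auto simp: substochastic_def)
  have "ennreal (prob_first_entry S i j k) = ennreal (S $$ (k, j)) +
      (\<integral>\<^sup>+z\<in>?F. emeasure (markov_chain (transition S) z) (enters_via ?F (Some j)) \<partial>transition S (Some k))"
    using first_step_equation[of "Some j" ?F "transition S" "Some k"] j by (simp add: em pmf)
  also have "(\<integral>\<^sup>+z\<in>?F. emeasure (markov_chain (transition S) z) (enters_via ?F (Some j)) \<partial>transition S (Some k)) =
      (\<Sum>z\<in>Some ` ?R. emeasure (markov_chain (transition S) z) (enters_via ?F (Some j)) * indicator ?F z *
        ennreal (pmf (transition S (Some k)) z))"
  proof (rule nn_integral_measure_pmf_support)
    fix z
    assume "z \<in> set_pmf (transition S (Some k))" "z \<notin> Some ` ?R"
    then show "emeasure (markov_chain (transition S) z) (enters_via ?F (Some j)) * indicator ?F z = 0"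
      by (cases z) (auto simp: set_pmf_iff pmf split: if_splits)
  qed auto
  also have "\<dots> = (\<Sum>l\<in>?R. ennreal (S $$ (k, l) * prob_first_entry S i j l))"
    by (simp add: sum.reindex em pmf indicator_def ennreal_mult nonneg prob_first_entry_nonneg mult.commute)
  also have "\<dots> = ennreal (\<Sum>l\<in>?R. S $$ (k, l) * prob_first_entry S i j l)"
    by (rule sum_ennreal) (simp add: prob_first_entry_nonneg nonneg)
  finally have "ennreal (prob_first_entry S i j k) =
      ennreal (S $$ (k, j)) + ennreal (\<Sum>l\<in>?R. S $$ (k, l) * prob_first_entry S i j l)" .
  moreover have "0 \<le> (\<Sum>l\<in>?R. S $$ (k, l) * prob_first_entry S i j l)"
    by (intro sum_nonneg mult_nonneg_nonneg nonneg prob_first_entry_nonneg) auto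
  ultimately show ?thesis
    using nonneg[OF j] by (simp add: prob_first_entry_nonneg ennreal_plus[symmetric] del: ennreal_plus)
qed

section \<open>A maximum principle for irreducible matrices\<close>

lemma power_entry_outside_closed_set:
  fixes S :: "real mat"
  assumes S: "S \<in> carrier_mat L L"
    and closed: "\<And>k l. k \<in> A \<Longrightarrow> l < L \<Longrightarrow> l \<notin> A \<Longrightarrow> S $$ (k, l) = 0"
    and A: "A \<subseteq> {..<L}"
  shows "k \<in> A \<Longrightarrow> l < L \<Longrightarrow> l \<notin> A \<Longrightarrow> (S ^\<^sub>m n) $$ (k, l) = 0"
proof (induction n arbitrary: l)
  case 0
  then show ?case
    using S A by auto
next
  case (Suc n)
  have k: "k < L"
    using Suc.prems A by auto
  have Sn: "S ^\<^sub>m n \<in> carrier_mat L L"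
    using S by (rule pow_carrier_mat)
  have "(S ^\<^sub>m Suc n) $$ (k, l) = (\<Sum>m\<in>{0..<L}. (S ^\<^sub>m n) $$ (k, m) * S $$ (m, l))"
    using S Sn k Suc.prems by (simp add: scalar_prod_def)
  also have "\<dots> = 0"
  proof (rule sum.neutral, rule ballI)
    fix m
    assume "m \<in> {0..<L}"
    then show "(S ^\<^sub>m n) $$ (k, m) * S $$ (m, l) = 0"
      using Suc.IH[of m] Suc.prems closed[of m l] by (cases "m \<in> A") auto
  qed
  finally show ?case .
qed

text \<open>
  The states where \<open>\<bar>y\<bar>\<close> attains its maximum \<open>m\<close> form a closed set if \<open>m > 0\<close>: there \<open>\<bar>y\<bar>\<close> is at most a
  substochastic average of its values, so all successors attain \<open>m\<close> too. Irreducibility would lead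
  from this set to \<open>b\<close>, where \<open>y\<close> vanishes. The equation is asked for only where \<open>y\<close> does not vanish, which
  covers at once the boundary \<open>{0}\<close> and the boundary \<open>{i, j}\<close>.
\<close>

theorem maximum_principle:
  fixes y :: "nat \<Rightarrow> real"
  assumes S: "S \<in> carrier_mat L L" and irr: "irreducible_matrix S" and sub: "substochastic S"
    and harmonic: "\<And>k. k < L \<Longrightarrow> y k = 0 \<or> y k = (\<Sum>l<L. S $$ (k, l) * y l)"
    and b: "b < L" "y b = 0"
    and k: "k < L"
  shows "y k = 0"
proof (rule ccontr)
  assume nz: "y k \<noteq> 0"
  define m where "m = Max ((\<lambda>k. \<bar>y k\<bar>) ` {..<L})"
  have le: "\<bar>y l\<bar> \<le> m" if "l < L" for l
    unfolding m_def using that by (intro Max_ge) auto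
  have m: "0 < m"
    using le[OF k] nz by simp
  define A where "A = {l. l < L \<and> \<bar>y l\<bar> = m}"
  have "m \<in> (\<lambda>k. \<bar>y k\<bar>) ` {..<L}"
    unfolding m_def using k by (intro Max_in) auto
  then obtain a where a: "a \<in> A"
    by (auto simp: A_def)
  have nonneg: "0 \<le> S $$ (k, l)" if "k < L" "l < L" for k l
    using sub S that by (auto simp: substochastic_def)
  have "S $$ (k, l) = 0" if k: "k \<in> A" and l: "l < L" "l \<notin> A" for k l
  proof -
    have kL: "k < L" "\<bar>y k\<bar> = m"
      using k by (auto simp: A_def)
    have "m = \<bar>\<Sum>l<L. S $$ (k, l) * y l\<bar>"
      using harmonic[of k] kL m by auto
    also have "\<dots> \<le> (\<Sum>l<L. \<bar>S $$ (k, l) * y l\<bar>)"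
      by (rule sum_abs)
    also have "\<dots> = (\<Sum>l<L. S $$ (k, l) * \<bar>y l\<bar>)"
      using nonneg kL by (intro sum.cong) (auto simp: abs_mult)
    finally have "m \<le> (\<Sum>l<L. S $$ (k, l) * \<bar>y l\<bar>)" .
    moreover have "(\<Sum>l<L. S $$ (k, l) * m) \<le> 1 * m"
      unfolding sum_distrib_right[symmetric]
      using sub S kL m by (intro mult_right_mono) (auto simp: substochastic_def)
    ultimately have "(\<Sum>l<L. S $$ (k, l) * (m - \<bar>y l\<bar>)) \<le> 0"
      by (simp add: right_diff_distrib sum_subtractf)
    moreover have terms: "0 \<le> S $$ (k, l) * (m - \<bar>y l\<bar>)" if "l < L" for l
      using nonneg le that kL by simp
    ultimately have "(\<Sum>l<L. S $$ (k, l) * (m - \<bar>y l\<bar>)) = 0"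
      by (intro antisym sum_nonneg) auto
    then have "S $$ (k, l) * (m - \<bar>y l\<bar>) = 0"
      using terms l by (subst (asm) sum_nonneg_eq_0_iff) auto
    then show ?thesis
      using l by (auto simp: A_def)
  qed
  moreover have "b \<notin> A" "A \<subseteq> {..<L}"
    using b m by (auto simp: A_def)
  ultimately have "(S ^\<^sub>m n) $$ (a, b) = 0" for n
    using a b by (intro power_entry_outside_closed_set[OF S]) auto
  then show False
    using irr S a b by (force simp: irreducible_matrix_def A_def)
qed

section \<open>Killing the chain when it leaves state 0\<close>

text \<open>
  The matrix \<open>I - S'\<close>, where \<open>S'\<close> is \<open>S\<close> with row \<open>0\<close> replaced by zero: the chain is killed as soon as it
  leaves state \<open>0\<close>. Unlike \<open>I - S\<close>, it is invertible for irreducible stochastic \<open>S\<close> too.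
\<close>

definition cut_matrix :: "nat \<Rightarrow> real mat \<Rightarrow> real mat" where
  "cut_matrix L S = mat L L (\<lambda>(k, l). of_bool (k = l) - (if k = 0 then 0 else S $$ (k, l)))"

lemma mat_inverse_cut_matrix:
  assumes L: "1 \<le> L" and S: "S \<in> carrier_mat L L"
    and irr: "irreducible_matrix S" and sub: "substochastic S"
  obtains B where "mat_inverse (cut_matrix L S) = Some B" "B \<in> carrier_mat L L"
    "cut_matrix L S * B = 1\<^sub>m L" "B * cut_matrix L S = 1\<^sub>m L"
proof -
  let ?M = "cut_matrix L S"
  have M: "?M \<in> carrier_mat L L"
    by (simp add: cut_matrix_def)
  have "det ?M \<noteq> 0"
  proof
    assume "det ?M = 0"
    then obtain v where v: "v \<in> carrier_vec L" "v \<noteq> 0\<^sub>v L" "?M *\<^sub>v v = 0\<^sub>v L"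
      using det_0_iff_vec_prod_zero[OF M] by auto
    have Mv: "(?M *\<^sub>v v) $ k = (\<Sum>l<L. (of_bool (k = l) - (if k = 0 then 0 else S $$ (k, l))) * v $ l)"
      if "k < L" for k
      using v(1) that by (simp add: cut_matrix_def scalar_prod_def lessThan_atLeast0)
    have eq: "v $ k = (if k = 0 then 0 else \<Sum>l<L. S $$ (k, l) * v $ l)" if k: "k < L" for k
    proof -
      have "0 = (?M *\<^sub>v v) $ k"
        using v k by simp
      also have "\<dots> = (\<Sum>l<L. (of_bool (k = l) - (if k = 0 then 0 else S $$ (k, l))) * v $ l)"
        by (rule Mv[OF k])
      also have "\<dots> = v $ k - (if k = 0 then 0 else \<Sum>l<L. S $$ (k, l) * v $ l)"
        using k by (simp add: left_diff_distrib sum_subtractf of_bool_def if_distrib[of "\<lambda>x. x * _"] cong: if_cong)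
      finally show ?thesis by simp
    qed
    have "v $ k = 0" if "k < L" for k
    proof (rule maximum_principle[OF S irr sub, where y = "vec_index v" and b = 0, OF _ _ _ that])
      fix l
      assume "l < L"
      then show "v $ l = 0 \<or> v $ l = (\<Sum>m<L. S $$ (l, m) * v $ m)"
        using eq[of l] by (cases "l = 0") simp_all
    qed (use L eq[of 0] in simp_all)
    with v show False
      by (metis eq_vecI carrier_vecD index_zero_vec)
  qed
  then have "?M \<in> Units (ring_mat TYPE(real) L ())"
    by (rule det_non_zero_imp_unit[OF M])
  then obtain B where "mat_inverse ?M = Some B"
    using mat_inverse(1)[OF M] by fastforce
  with mat_inverse(2)[OF M this] that show thesis
    by blast
qed

section \<open>Three linear equations\<close>

lemma trivial_kernel_imp_det3_nonzero:
  fixes a1 :: real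
  assumes ker: "\<And>x y z. a1 * x + a2 * y + a3 * z = 0 \<Longrightarrow> b1 * x + b2 * y + b3 * z = 0 \<Longrightarrow>
      c1 * x + c2 * y + c3 * z = 0 \<Longrightarrow> x = 0 \<and> y = 0 \<and> z = 0"
  shows "a1 * (b2 * c3 - b3 * c2) - a2 * (b1 * c3 - b3 * c1) + a3 * (b1 * c2 - b2 * c1) \<noteq> 0"
proof -
  let ?A = "vector [vector [a1, a2, a3], vector [b1, b2, b3], vector [c1, c2, c3]] :: real^3^3"
  have "x = 0" if Ax: "?A *v x = 0" for x
  proof -
    have row: "(\<Sum>m\<in>UNIV. vec_nth (vec_nth ?A r) m * vec_nth x m) = 0" for r
      using arg_cong[OF Ax, of "\<lambda>v. vec_nth v r"] by (simp add: matrix_vector_mult_def)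
    have "\<forall>m. vec_nth x m = 0"
      unfolding forall_3 using row[of 1] row[of 2] row[of 3] by (intro ker) (simp_all add: sum_3)
    then show ?thesis
      by (simp add: Finite_Cartesian_Product.vec_eq_iff)
  qed
  then have "invertible ?A"
    using invertible_left_inverse matrix_left_invertible_ker by blast
  then show ?thesis
    by (simp add: invertible_det_nz det_3 vector_3 algebra_simps)
qed

lemma cramer_3_second_unknown:
  fixes a1 :: real
  assumes "a1 * x + a2 * y + a3 * z = 1" "b1 * x + b2 * y + b3 * z = 0" "c1 * x + c2 * y + c3 * z = 0"
  shows "y * (a1 * (b2 * c3 - b3 * c2) - a2 * (b1 * c3 - b3 * c1) + a3 * (b1 * c2 - b2 * c1)) =
    b3 * c1 - b1 * c3"
proof -
  have "y * (a1 * (b2 * c3 - b3 * c2) - a2 * (b1 * c3 - b3 * c1) + a3 * (b1 * c2 - b2 * c1)) =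
      (b3 * c1 - b1 * c3) * (a1 * x + a2 * y + a3 * z)
      + (a1 * c3 - a3 * c1) * (b1 * x + b2 * y + b3 * z)
      + (a3 * b1 - a1 * b3) * (c1 * x + c2 * y + c3 * z)"
    by (simp add: algebra_simps)
  then show ?thesis
    by (simp add: assms)
qed

section \<open>The coefficients as quotients\<close>

text \<open>
  For the inverse \<open>B\<close> of \<open>cut_matrix L S\<close>, this is the expected number of visits to \<open>l\<close> by the chain
  started in \<open>0\<close>, from time \<open>1\<close> until its first return to \<open>0\<close> inclusive. In particular
  \<open>1 - excursion_visits L S B 0\<close> is the probability of never returning to \<open>0\<close>.
\<close>

definition excursion_visits :: "nat \<Rightarrow> real mat \<Rightarrow> real mat \<Rightarrow> nat \<Rightarrow> real" where
  "excursion_visits L S B l = (\<Sum>k<L. S $$ (0, k) * B $$ (k, l))"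

text \<open>
  If \<open>d = 1 - excursion_visits L S B 0\<close> is not zero, then \<open>N = (I - S)\<^sup>-\<^sup>1\<close> exists, and the rank-one update from
  \<open>cut_matrix L S\<close> to \<open>I - S\<close> gives \<open>Q_numerator L S B i j = d * N\<^sub>i\<^sub>j\<close>. Likewise
  \<open>Q_denominator L S B i j = d * (N\<^sub>i\<^sub>i * N\<^sub>j\<^sub>j - N\<^sub>i\<^sub>j * N\<^sub>j\<^sub>i)\<close>: a single factor \<open>d\<close> clears the fractions in this
  determinant, because the terms with \<open>1 / d\<^sup>2\<close> cancel in it. Both are polynomials in the entries of
  \<open>B\<close> and the values of \<open>excursion_visits\<close>, and so they make sense for \<open>d = 0\<close> too.
\<close>

definition Q_numerator :: "nat \<Rightarrow> real mat \<Rightarrow> real mat \<Rightarrow> nat \<Rightarrow> nat \<Rightarrow> real" where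
  "Q_numerator L S B i j =
     (1 - excursion_visits L S B 0) * B $$ (i, j) + B $$ (i, 0) * excursion_visits L S B j"

definition Q_denominator :: "nat \<Rightarrow> real mat \<Rightarrow> real mat \<Rightarrow> nat \<Rightarrow> nat \<Rightarrow> real" where
  "Q_denominator L S B i j =
     Q_numerator L S B i i * B $$ (j, j) - Q_numerator L S B i j * B $$ (j, i)
     + (B $$ (i, i) * excursion_visits L S B j - B $$ (i, j) * excursion_visits L S B i) * B $$ (j, 0)"

lemma sum_cut_matrix:
  assumes "k < L"
  shows "(\<Sum>l<L. cut_matrix L S $$ (k, l) * x l) =
    x k - (if k = 0 then 0 else \<Sum>l<L. S $$ (k, l) * x l)"
  using assms
  by (simp add: cut_matrix_def left_diff_distrib sum_subtractf of_bool_def if_distrib[of "\<lambda>x. x * _"] cong: if_cong)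

lemma sum_mat_mult:
  fixes A B :: "real mat"
  assumes "A \<in> carrier_mat L L" "B \<in> carrier_mat L L" "A * B = C" "k < L" "l < L"
  shows "(\<Sum>m<L. A $$ (k, m) * B $$ (m, l)) = C $$ (k, l)"
  using assms(1,2,4,5) unfolding assms(3)[symmetric] by (simp add: scalar_prod_def lessThan_atLeast0)

text \<open>
  The determinant, expanded along its first row, of the matrix with the rows
  \<open>(B\<^sub>j\<^sub>j, - B\<^sub>j\<^sub>i, B\<^sub>j\<^sub>0)\<close>, \<open>(B\<^sub>i\<^sub>j, - B\<^sub>i\<^sub>i, B\<^sub>i\<^sub>0)\<close> and \<open>(w\<^sub>j, - w\<^sub>i, - (1 - w\<^sub>0))\<close>, where \<open>w = excursion_visits L S B\<close>.
\<close>

lemma Q_denominator_eq_det3: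
  "Q_denominator L S B i j =
    B $$ (j, j) * (- B $$ (i, i) * - (1 - excursion_visits L S B 0) - B $$ (i, 0) * - excursion_visits L S B i)
    - - B $$ (j, i) * (B $$ (i, j) * - (1 - excursion_visits L S B 0) - B $$ (i, 0) * excursion_visits L S B j)
    + B $$ (j, 0) * (B $$ (i, j) * - excursion_visits L S B i - - B $$ (i, i) * excursion_visits L S B j)"
  by (simp add: Q_denominator_def Q_numerator_def algebra_simps)

context
  fixes L :: nat and S B :: "real mat"
  assumes L: "1 \<le> L" and S: "S \<in> carrier_mat L L" and B: "B \<in> carrier_mat L L"
    and inv_right: "cut_matrix L S * B = 1\<^sub>m L" and inv_left: "B * cut_matrix L S = 1\<^sub>m L"
begin

lemma cut_carrier: "cut_matrix L S \<in> carrier_mat L L"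
  by (simp add: cut_matrix_def)

text \<open>
  Replacing \<open>I - S\<close> by \<open>cut_matrix L S\<close> changes row \<open>0\<close> of the system only; the row that is lost enters
  the right-hand side through the single number \<open>\<sigma>\<close>. Multiplication by \<open>B\<close> expresses \<open>x\<close> by \<open>p\<close>, \<open>q\<close>
  and \<open>\<sigma>\<close>, and inserting this into the definition of \<open>\<sigma>\<close> gives one more linear equation.
\<close>

lemma solution_via_inverse:
  fixes x :: "nat \<Rightarrow> real"
  assumes ij: "i < L" "j < L"
    and x: "\<And>k. k < L \<Longrightarrow> x k - (\<Sum>l<L. S $$ (k, l) * x l) = p * of_bool (k = j) - q * of_bool (k = i)"
  defines "\<sigma> \<equiv> \<Sum>l<L. S $$ (0, l) * x l"
  shows "k < L \<Longrightarrow> x k = p * B $$ (k, j) - q * B $$ (k, i) + \<sigma> * B $$ (k, 0)"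
    and "\<sigma> = p * excursion_visits L S B j - q * excursion_visits L S B i + \<sigma> * excursion_visits L S B 0"
proof -
  have Mx: "(\<Sum>l<L. cut_matrix L S $$ (k, l) * x l) =
      p * of_bool (k = j) - q * of_bool (k = i) + \<sigma> * of_bool (k = 0)" if "k < L" for k
    using x[OF that] that by (auto simp: sum_cut_matrix \<sigma>_def)
  have sol: "x k = p * B $$ (k, j) - q * B $$ (k, i) + \<sigma> * B $$ (k, 0)" if k: "k < L" for k
  proof -
    have "x k = (\<Sum>l<L. 1\<^sub>m L $$ (k, l) * x l)"
      using k by (simp add: if_distrib[of "\<lambda>x. x * _"] cong: if_cong)
    also have "\<dots> = (\<Sum>l<L. (\<Sum>m<L. B $$ (k, m) * cut_matrix L S $$ (m, l)) * x l)"
      using k sum_mat_mult[OF B cut_carrier inv_left] by simp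
    also have "\<dots> = (\<Sum>m<L. B $$ (k, m) * (\<Sum>l<L. cut_matrix L S $$ (m, l) * x l))"
      unfolding sum_distrib_left sum_distrib_right
      by (subst sum.swap) (simp add: mult.assoc)
    also have "\<dots> = (\<Sum>m<L. B $$ (k, m) * (p * of_bool (m = j) - q * of_bool (m = i) + \<sigma> * of_bool (m = 0)))"
      by (simp add: Mx)
    also have "\<dots> = (\<Sum>m<L. (if m = j then p * B $$ (k, m) else 0) - (if m = i then q * B $$ (k, m) else 0)
        + (if m = 0 then \<sigma> * B $$ (k, m) else 0))"
      by (intro sum.cong) (auto simp: algebra_simps)
    also have "\<dots> = p * B $$ (k, j) - q * B $$ (k, i) + \<sigma> * B $$ (k, 0)"
      using ij L by (simp add: sum.distrib sum_subtractf)
    finally show ?thesis .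
  qed
  show "k < L \<Longrightarrow> x k = p * B $$ (k, j) - q * B $$ (k, i) + \<sigma> * B $$ (k, 0)"
    by (rule sol)
  have "\<sigma> = (\<Sum>k<L. S $$ (0, k) * (p * B $$ (k, j) - q * B $$ (k, i) + \<sigma> * B $$ (k, 0)))"
    unfolding \<sigma>_def[unfolded atomize_eq] by (intro sum.cong arg_cong2[of _ _ _ _ times] refl) (simp add: sol[unfolded \<sigma>_def])
  then show "\<sigma> = p * excursion_visits L S B j - q * excursion_visits L S B i + \<sigma> * excursion_visits L S B 0"
    by (simp add: excursion_visits_def sum_distrib_left sum.distrib sum_subtractf algebra_simps)
qed

text \<open>
  The converse of the previous lemma. A triple in the kernel of the three by three matrix thus becomes
  a vector to which the maximum principle applies.
\<close>

lemma inverse_combination_solves: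
  assumes ij: "i < L" "j < L" and k: "k < L"
    and \<sigma>: "\<sigma> = p * excursion_visits L S B j - q * excursion_visits L S B i + \<sigma> * excursion_visits L S B 0"
  defines "y \<equiv> \<lambda>k. p * B $$ (k, j) - q * B $$ (k, i) + \<sigma> * B $$ (k, 0)"
  shows "y k - (\<Sum>l<L. S $$ (k, l) * y l) = p * of_bool (k = j) - q * of_bool (k = i)"
proof -
  have "(\<Sum>l<L. cut_matrix L S $$ (k, l) * y l) =
      p * (\<Sum>l<L. cut_matrix L S $$ (k, l) * B $$ (l, j)) - q * (\<Sum>l<L. cut_matrix L S $$ (k, l) * B $$ (l, i))
      + \<sigma> * (\<Sum>l<L. cut_matrix L S $$ (k, l) * B $$ (l, 0))"
    by (simp add: y_def sum_distrib_left sum.distrib sum_subtractf algebra_simps)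
  also have "\<dots> = p * of_bool (k = j) - q * of_bool (k = i) + \<sigma> * of_bool (k = 0)"
    using ij k L by (simp add: sum_mat_mult[OF cut_carrier B inv_right])
  finally have 1: "y k - (if k = 0 then 0 else \<Sum>l<L. S $$ (k, l) * y l) =
      p * of_bool (k = j) - q * of_bool (k = i) + \<sigma> * of_bool (k = 0)"
    using k by (simp add: sum_cut_matrix)
  have "(\<Sum>l<L. S $$ (0, l) * y l) =
      p * excursion_visits L S B j - q * excursion_visits L S B i + \<sigma> * excursion_visits L S B 0"
    by (simp add: y_def excursion_visits_def sum_distrib_left sum.distrib sum_subtractf algebra_simps)
  then have "(\<Sum>l<L. S $$ (0, l) * y l) = \<sigma>"
    using \<sigma> by simp
  with 1 show ?thesis
    by (auto split: if_splits)
qed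

text \<open>
  A triple \<open>(p, q, \<sigma>)\<close> in the kernel of the three by three matrix yields a vector \<open>y\<close> that vanishes in \<open>i\<close>
  and \<open>j\<close> and is a fixed point of \<open>S\<close> in all other states. So \<open>y = 0\<close> by the maximum principle, and its
  equations in \<open>j\<close>, in \<open>i\<close> and its value in \<open>0\<close> show that \<open>p\<close>, \<open>q\<close> and \<open>\<sigma>\<close> vanish.
\<close>

lemma Q_denominator_nonzero:
  assumes irr: "irreducible_matrix S" and sub: "substochastic S"
    and ij: "i < L" "j < L" "i \<noteq> j"
  shows "Q_denominator L S B i j \<noteq> 0"
proof -
  let ?w = "excursion_visits L S B"
  have ker: "p = 0 \<and> q = 0 \<and> \<sigma> = 0"
    if j0: "B $$ (j, j) * p + - B $$ (j, i) * q + B $$ (j, 0) * \<sigma> = 0"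
      and i0: "B $$ (i, j) * p + - B $$ (i, i) * q + B $$ (i, 0) * \<sigma> = 0"
      and 0: "?w j * p + - ?w i * q + - (1 - ?w 0) * \<sigma> = 0" for p q \<sigma>
  proof -
    define y where "y = (\<lambda>k. p * B $$ (k, j) - q * B $$ (k, i) + \<sigma> * B $$ (k, 0))"
    have \<sigma>: "\<sigma> = p * ?w j - q * ?w i + \<sigma> * ?w 0"
      using 0 by (simp add: algebra_simps)
    have y: "y k - (\<Sum>l<L. S $$ (k, l) * y l) = p * of_bool (k = j) - q * of_bool (k = i)" if "k < L" for k
      unfolding y_def by (rule inverse_combination_solves[OF ij(1,2) that \<sigma>])
    \<comment> \<open>Rows one and two of the kernel condition are the values of \<open>y\<close> in \<open>j\<close> and \<open>i\<close>.\<close>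
    have yij: "y i = 0" "y j = 0"
      using i0 j0 by (simp_all add: y_def algebra_simps)
    have y0: "y k = 0" if "k < L" for k
    proof (rule maximum_principle[OF S irr sub, where y = y and b = i, OF _ ij(1) yij(1) that])
      fix k
      assume k: "k < L"
      show "y k = 0 \<or> y k = (\<Sum>l<L. S $$ (k, l) * y l)"
        using y[OF k] yij by (cases "k = i \<or> k = j") auto
    qed
    have "p = 0" "q = 0"
      using y[of j] y[of i] y0 ij by simp_all
    moreover have "B $$ (0, 0) = 1"
    proof -
      have "(\<Sum>m<L. cut_matrix L S $$ (0, m) * B $$ (m, 0)) = 1"
        using L by (simp add: sum_mat_mult[OF cut_carrier B inv_right])
      then show ?thesis
        using L by (simp add: sum_cut_matrix)
    qed
    ultimately show ?thesis
      using y0[of 0] L by (simp add: y_def)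
  qed
  show ?thesis
    unfolding Q_denominator_eq_det3 using ker by (rule trivial_kernel_imp_det3_nonzero)
qed

text \<open>
  The solution \<open>h\<close> is replaced by the vector \<open>x\<close> that agrees with it outside \<open>{i, j}\<close> and has boundary values \<open>0\<close>
  in \<open>i\<close> and \<open>1\<close> in \<open>j\<close>. Then \<open>S x = h\<close>, so \<open>(I - S) x = x - h\<close> is supported on \<open>{i, j}\<close>, and the boundary
  values are two linear equations for \<open>1 - h j\<close>, \<open>h i\<close> and \<open>\<sigma>\<close>. The equation for \<open>\<sigma>\<close> is the third.
\<close>

lemma first_step_solution_eq_quotient:
  fixes h :: "nat \<Rightarrow> real"
  assumes irr: "irreducible_matrix S" and sub: "substochastic S"
    and ij: "i < L" "j < L" "i \<noteq> j"
    and h: "\<And>k. k < L \<Longrightarrow> h k = S $$ (k, j) + (\<Sum>l\<in>{..<L} - {i, j}. S $$ (k, l) * h l)"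
  shows "h i = Q_numerator L S B i j / Q_denominator L S B i j"
proof -
  let ?w = "excursion_visits L S B"
  define x where "x = (\<lambda>k. if k = i then 0 else if k = j then 1 else h k)"
  have "(\<Sum>l<L. S $$ (k, l) * x l) = h k" if "k < L" for k
  proof -
    have "(\<Sum>l<L. S $$ (k, l) * x l) =
        (\<Sum>l\<in>{..<L} - {i, j}. S $$ (k, l) * x l) + (\<Sum>l\<in>{i, j}. S $$ (k, l) * x l)"
      using ij by (intro sum.subset_diff) auto
    also have "(\<Sum>l\<in>{..<L} - {i, j}. S $$ (k, l) * x l) = (\<Sum>l\<in>{..<L} - {i, j}. S $$ (k, l) * h l)"
      by (intro sum.cong) (auto simp: x_def)
    finally show ?thesis
      using h[OF that] ij by (simp add: x_def)
  qed
  then have x: "x k - (\<Sum>l<L. S $$ (k, l) * x l) = (1 - h j) * of_bool (k = j) - h i * of_bool (k = i)"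
    if "k < L" for k
    using that ij by (simp add: x_def)
  define \<sigma> where "\<sigma> = (\<Sum>l<L. S $$ (0, l) * x l)"
  have "B $$ (j, j) * (1 - h j) + - B $$ (j, i) * h i + B $$ (j, 0) * \<sigma> = 1"
    using solution_via_inverse(1)[OF ij(1,2) x ij(2)] ij by (simp add: x_def \<sigma>_def mult.commute)
  moreover have "B $$ (i, j) * (1 - h j) + - B $$ (i, i) * h i + B $$ (i, 0) * \<sigma> = 0"
    using solution_via_inverse(1)[OF ij(1,2) x ij(1)] ij by (simp add: x_def \<sigma>_def mult.commute)
  moreover have "?w j * (1 - h j) + - ?w i * h i + - (1 - ?w 0) * \<sigma> = 0"
    using solution_via_inverse(2)[OF ij(1,2) x, folded \<sigma>_def] by (simp add: algebra_simps)
  ultimately have "h i * Q_denominator L S B i j = B $$ (i, 0) * ?w j - B $$ (i, j) * - (1 - ?w 0)"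
    unfolding Q_denominator_eq_det3 by (rule cramer_3_second_unknown)
  also have "\<dots> = Q_numerator L S B i j"
    by (simp add: Q_numerator_def algebra_simps)
  finally have "h i * Q_denominator L S B i j = Q_numerator L S B i j" .
  then show ?thesis
    using Q_denominator_nonzero[OF irr sub ij] by (simp add: field_simps)
qed

end

section \<open>Reasoning about programs\<close>

text \<open>
  A syntactic bound, valid for every input; a conditional is charged for both branches. It keeps the
  count of operations out of all correctness arguments.
\<close>

primrec max_operations :: "nat \<Rightarrow> com \<Rightarrow> nat" where
  "max_operations L Skip = 0"
| "max_operations L (Assign a u v t) = operations t"
| "max_operations L (Seq c d) = max_operations L c + max_operations L d"
| "max_operations L (IfEq u v c d) = max_operations L c + max_operations L d"
| "max_operations L (For u c) = L * max_operations L c"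

lemma exec_operations_le:
  "exec L c e p = Some p' \<Longrightarrow> snd p' \<le> snd p + max_operations L c"
proof (induction c arbitrary: e p p')
  case (Seq c d)
  then obtain q where "exec L c e p = Some q" "exec L d e q = Some p'"
    by (auto simp: bind_eq_Some_conv)
  with Seq.IH[of e p q] Seq.IH(2)[of e q p'] show ?case
    by simp
next
  case (IfEq u v c d)
  show ?case
    using IfEq.prems IfEq.IH(1)[of e p p'] IfEq.IH(2)[of e p p'] by (auto split: if_splits)
next
  case (For u c)
  have "snd q \<le> snd p + m * max_operations L c"
    if "fold (\<lambda>k r. Option.bind r (exec L c (e(u := k)))) [0..<m] (Some p) = Some q" for m q
    using that
  proof (induction m arbitrary: q)
    case (Suc m)
    then obtain r where r: "fold (\<lambda>k r. Option.bind r (exec L c (e(u := k)))) [0..<m] (Some p) = Some r"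
      and q: "exec L c (e(u := m)) r = Some q"
      by (auto simp: bind_eq_Some_conv simp del: fun_upd_apply)
    show ?case
      using Suc.IH[OF r] For.IH[OF q] by simp
  qed simp
  then show ?case
    using For.prems by simp
qed auto

text \<open>
  The operation count is quantified away on both sides, so that only the arrays matter.
\<close>

definition transforms :: "nat \<Rightarrow> com \<Rightarrow> indices \<Rightarrow> arrays \<Rightarrow> arrays \<Rightarrow> bool" where
  "transforms L c e A A' \<longleftrightarrow> (\<forall>n. \<exists>n'. exec L c e (A, n) = Some (A', n'))"

lemma transforms_Assign:
  "eval e A t = Some x \<Longrightarrow> A' = A(a := (A a)(e u := (A a (e u))(e v := x))) \<Longrightarrow> transforms L (Assign a u v t) e A A'"
  by (simp add: transforms_def update_entry_def)

lemma transforms_Seq: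
  "transforms L c e A A' \<Longrightarrow> transforms L d e A' A'' \<Longrightarrow> transforms L (Seq c d) e A A''"
  unfolding transforms_def by (metis exec.simps(3) bind.bind_lunit)

lemma transforms_IfEq:
  "(e u = e v \<Longrightarrow> transforms L c e A A') \<Longrightarrow> (e u \<noteq> e v \<Longrightarrow> transforms L d e A A') \<Longrightarrow>
    transforms L (IfEq u v c d) e A A'"
  by (simp add: transforms_def)

text \<open>
  The invariant is a function \<open>F\<close> that gives the exact contents of the arrays before each round.
\<close>

lemma transforms_For:
  assumes step: "\<And>k. k < L \<Longrightarrow> transforms L c (e(u := k)) (F k) (F (Suc k))"
    and "A = F 0" "A' = F L"
  shows "transforms L (For u c) e A A'"
proof -
  have "\<exists>n'. fold (\<lambda>k r. Option.bind r (exec L c (e(u := k)))) [0..<m] (Some (F 0, n)) = Some (F m, n')"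
    if "m \<le> L" for m n
    using that
  proof (induction m)
    case (Suc m)
    then obtain n' where
      "fold (\<lambda>k r. Option.bind r (exec L c (e(u := k)))) [0..<m] (Some (F 0, n)) = Some (F m, n')"
      by (auto simp del: fun_upd_apply)
    moreover obtain n'' where "exec L c (e(u := m)) (F m, n') = Some (F (Suc m), n'')"
      using step[of m] Suc.prems by (auto simp: transforms_def)
    ultimately show ?case
      by (simp del: fun_upd_apply)
  qed simp
  then show ?thesis
    using assms(2,3) by (simp add: transforms_def)
qed

text \<open>
  The contents \<open>X\<close> of the array that is being filled are arbitrary in the hypothesis: the entries are
  computed from the other arrays.
\<close>

lemma transforms_fill:
  assumes body: "\<And>k l X. k < L \<Longrightarrow> l < L \<Longrightarrow>
      transforms L c (e(u := k, v := l)) (A(a := X)) (A(a := X(k := (X k)(l := f k l))))"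
  shows "transforms L (For u (For v c)) e A (A(a := \<lambda>k l. if k < L \<and> l < L then f k l else A a k l))"
proof (rule transforms_For[where F = "\<lambda>m. A(a := \<lambda>k l. if k < m \<and> l < L then f k l else A a k l)"])
  fix k
  assume k: "k < L"
  show "transforms L (For v c) (e(u := k))
      (A(a := \<lambda>i j. if i < k \<and> j < L then f i j else A a i j))
      (A(a := \<lambda>i j. if i < Suc k \<and> j < L then f i j else A a i j))"
  proof (rule transforms_For[where F = "\<lambda>m. A(a := \<lambda>i j. if i < k \<and> j < L \<or> i = k \<and> j < m then f i j else A a i j)"])
    fix l
    assume l: "l < L"
    let ?X = "\<lambda>i j. if i < k \<and> j < L \<or> i = k \<and> j < l then f i j else A a i j"
    have "(\<lambda>i j. if i < k \<and> j < L \<or> i = k \<and> j < Suc l then f i j else A a i j) = ?X(k := (?X k)(l := f k l))"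
      by (auto simp: fun_eq_iff less_Suc_eq)
    then show "transforms L c (e(u := k, v := l)) (A(a := ?X))
        (A(a := \<lambda>i j. if i < k \<and> j < L \<or> i = k \<and> j < Suc l then f i j else A a i j))"
      using body[OF k l, of ?X] by simp
  qed (auto simp: fun_eq_iff less_Suc_eq)
qed auto

section \<open>The algorithm\<close>

text \<open>
  Here and below, no loop binds the index variable \<open>0\<close>, so that it denotes state \<open>0\<close>; the indices
  \<open>1\<close> and \<open>2\<close> are the row and the column of the entry that is computed, if nothing else is said.
\<close>

definition cut_program :: com where
  "cut_program = For 1 (For 2 (IfEq 1 0
     (IfEq 1 2 (Assign 1 1 2 One) (Assign 1 1 2 Zero))
     (IfEq 1 2 (Assign 1 1 2 (Minus One (Entry 0 1 2))) (Assign 1 1 2 (Minus Zero (Entry 0 1 2))))))"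

lemma transforms_cut_program:
  assumes "A 0 = array_of_mat L S"
  shows "transforms L cut_program (\<lambda>_. 0) A
    (A(1 := \<lambda>k l. if k < L \<and> l < L then cut_matrix L S $$ (k, l) else A 1 k l))"
  unfolding cut_program_def
proof (rule transforms_fill)
  fix k l X
  assume kl: "k < L" "l < L"
  show "transforms L (IfEq 1 0
     (IfEq 1 2 (Assign 1 1 2 One) (Assign 1 1 2 Zero))
     (IfEq 1 2 (Assign 1 1 2 (Minus One (Entry 0 1 2))) (Assign 1 1 2 (Minus Zero (Entry 0 1 2)))))
     ((\<lambda>_. 0)(1 := k, 2 := l)) (A(1 := X)) (A(1 := X(k := (X k)(l := cut_matrix L S $$ (k, l)))))"
    by (intro transforms_IfEq; rule transforms_Assign)
       (use kl assms in \<open>simp_all add: cut_matrix_def array_of_mat_def\<close>)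
qed

text \<open>
  Array \<open>4\<close> keeps the row vector \<open>excursion_visits\<close> in its row \<open>0\<close>. Here \<open>1\<close> is the position in this
  vector and \<open>2\<close> the summation index.
\<close>

definition excursion_visits_program :: com where
  "excursion_visits_program = For 1 (For 2
     (Assign 4 0 1 (Plus (Entry 4 0 1) (Times (Entry 0 0 2) (Entry 2 2 1)))))"

lemma transforms_excursion_visits_program:
  assumes "1 \<le> L" "A 0 = array_of_mat L S" "A 2 = array_of_mat L B" "A 4 = (\<lambda>_ _. 0)"
  shows "transforms L excursion_visits_program (\<lambda>_. 0) A
    (A(4 := \<lambda>k l. if k = 0 \<and> l < L then excursion_visits L S B l else 0))"
  unfolding excursion_visits_program_def
proof (rule transforms_For[where F = "\<lambda>m. A(4 := \<lambda>k l. if k = 0 \<and> l < m then excursion_visits L S B l else 0)"])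
  fix l
  assume l: "l < L"
  let ?G = "\<lambda>m. A(4 := \<lambda>i j. if i = 0 \<and> j < l then excursion_visits L S B j
      else if i = 0 \<and> j = l then \<Sum>k<m. S $$ (0, k) * B $$ (k, l) else 0)"
  show "transforms L (For 2 (Assign 4 0 1 (Plus (Entry 4 0 1) (Times (Entry 0 0 2) (Entry 2 2 1)))))
      ((\<lambda>_. 0)(1 := l))
      (A(4 := \<lambda>k j. if k = 0 \<and> j < l then excursion_visits L S B j else 0))
      (A(4 := \<lambda>k j. if k = 0 \<and> j < Suc l then excursion_visits L S B j else 0))"
  proof (rule transforms_For[where F = ?G])
    fix k
    assume k: "k < L"
    show "transforms L (Assign 4 0 1 (Plus (Entry 4 0 1) (Times (Entry 0 0 2) (Entry 2 2 1))))
        ((\<lambda>_. 0)(1 := l, 2 := k)) (?G k) (?G (Suc k))"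
      by (rule transforms_Assign) (use assms k l in \<open>auto simp: array_of_mat_def fun_eq_iff\<close>)
  qed (auto simp: excursion_visits_def fun_eq_iff less_Suc_eq)
qed (use assms in \<open>auto simp: fun_eq_iff\<close>)

definition numerator_exp :: "nat \<Rightarrow> nat \<Rightarrow> rexp" where
  "numerator_exp u v =
     Plus (Times (Minus One (Entry 4 0 0)) (Entry 2 u v)) (Times (Entry 2 u 0) (Entry 4 0 v))"

definition denominator_exp :: "nat \<Rightarrow> nat \<Rightarrow> rexp" where
  "denominator_exp u v =
     Plus (Minus (Times (numerator_exp u u) (Entry 2 v v)) (Times (numerator_exp u v) (Entry 2 v u)))
       (Times (Minus (Times (Entry 2 u u) (Entry 4 0 v)) (Times (Entry 2 u v) (Entry 4 0 u))) (Entry 2 v 0))"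

text \<open>
  The diagonal is left out because the two by two determinant has equal rows for \<open>i = j\<close>, so that the
  Q_denominator is zero.
\<close>

definition quotient_program :: com where
  "quotient_program = For 1 (For 2 (IfEq 1 2
     (Assign 3 1 2 Zero) (Assign 3 1 2 (Divide (numerator_exp 1 2) (denominator_exp 1 2)))))"

lemma transforms_quotient_program:
  assumes A2: "A 2 = array_of_mat L B" and A4: "\<And>l. l < L \<Longrightarrow> A 4 0 l = excursion_visits L S B l"
    and nz: "\<And>i j. i < L \<Longrightarrow> j < L \<Longrightarrow> i \<noteq> j \<Longrightarrow> Q_denominator L S B i j \<noteq> 0"
  shows "transforms L quotient_program (\<lambda>_. 0) A
    (A(3 := \<lambda>i j. if i < L \<and> j < L then (if i = j then 0 else Q_numerator L S B i j / Q_denominator L S B i j)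
       else A 3 i j))"
  unfolding quotient_program_def
proof (rule transforms_fill)
  fix i j X
  assume ij: "i < L" "j < L"
  let ?e = "(\<lambda>_. 0)(1 := i, 2 := j) :: indices"
  have num: "eval ?e (A(3 := X)) (numerator_exp u v) = Some (Q_numerator L S B (?e u) (?e v))"
    if "u = 1 \<or> u = 2" "v = 1 \<or> v = 2" for u v
    using that ij by (auto simp: numerator_exp_def Q_numerator_def A2 A4 array_of_mat_def)
  have den: "eval ?e (A(3 := X)) (denominator_exp 1 2) = Some (Q_denominator L S B i j)"
    using ij by (simp add: denominator_exp_def num[simplified] Q_denominator_def A2 A4 array_of_mat_def)
  show "transforms L (IfEq 1 2 (Assign 3 1 2 Zero)
      (Assign 3 1 2 (Divide (numerator_exp 1 2) (denominator_exp 1 2)))) ?e (A(3 := X))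
      (A(3 := X(i := (X i)(j := if i = j then 0 else Q_numerator L S B i j / Q_denominator L S B i j))))"
    by (intro transforms_IfEq; rule transforms_Assign) (use nz[OF ij] in \<open>simp_all add: num[simplified] den[simplified]\<close>)
qed

definition quotients_from_inverse :: com where
  "quotients_from_inverse = Seq excursion_visits_program quotient_program"

text \<open>
  Every loop nest has depth exactly two, so the bound is homogeneous of degree two in \<open>L\<close>, and its value
  for \<open>L = 1\<close> serves as the constant.
\<close>

lemma max_operations_quadratic:
  "max_operations L cut_program + max_operations L quotients_from_inverse =
    (max_operations 1 cut_program + max_operations 1 quotients_from_inverse) * L\<^sup>2"
  by (simp add: cut_program_def quotients_from_inverse_def excursion_visits_program_def quotient_program_def
      numerator_exp_def denominator_exp_def power2_eq_square algebra_simps)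

lemma run_computes_Q:
  assumes L: "1 \<le> L" and S: "S \<in> carrier_mat L L"
    and irr: "irreducible_matrix S" and sub: "substochastic S"
  obtains R n where "run_with_inversion L cut_program quotients_from_inverse S = Some (R, n)"
    "n \<le> max_operations L cut_program + max_operations L quotients_from_inverse"
    "\<And>i j. i < L \<Longrightarrow> j < L \<Longrightarrow> i \<noteq> j \<Longrightarrow> R $$ (i, j) = Q S i j"
proof -
  obtain B where inverse: "mat_inverse (cut_matrix L S) = Some B" and B: "B \<in> carrier_mat L L"
    and right: "cut_matrix L S * B = 1\<^sub>m L" and left: "B * cut_matrix L S = 1\<^sub>m L"
    using mat_inverse_cut_matrix[OF L S irr sub] by blast
  have nz: "Q_denominator L S B i j \<noteq> 0" if "i < L" "j < L" "i \<noteq> j" for i j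
    by (rule Q_denominator_nonzero[OF L S B right left irr sub that])
  define A\<^sub>0 :: arrays where "A\<^sub>0 = (\<lambda>_ _ _. 0)(0 := array_of_mat L S)"
  define A\<^sub>1 where "A\<^sub>1 = A\<^sub>0(1 := \<lambda>k l. if k < L \<and> l < L then cut_matrix L S $$ (k, l) else A\<^sub>0 1 k l)"
  define A\<^sub>2 where "A\<^sub>2 = A\<^sub>1(2 := array_of_mat L B)"
  define A\<^sub>3 where "A\<^sub>3 = A\<^sub>2(4 := \<lambda>k l. if k = 0 \<and> l < L then excursion_visits L S B l else 0)"
  define A\<^sub>4 where "A\<^sub>4 = A\<^sub>3(3 := \<lambda>i j. if i < L \<and> j < L
    then (if i = j then 0 else Q_numerator L S B i j / Q_denominator L S B i j) else A\<^sub>3 3 i j)"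
  have "transforms L cut_program (\<lambda>_. 0) A\<^sub>0 A\<^sub>1"
    unfolding A\<^sub>1_def by (rule transforms_cut_program) (simp add: A\<^sub>0_def)
  then obtain m where prep: "exec L cut_program (\<lambda>_. 0) (A\<^sub>0, 0) = Some (A\<^sub>1, m)"
    unfolding transforms_def by blast
  have "transforms L excursion_visits_program (\<lambda>_. 0) A\<^sub>2 A\<^sub>3"
    unfolding A\<^sub>3_def using L
    by (rule transforms_excursion_visits_program) (simp_all add: A\<^sub>2_def A\<^sub>1_def A\<^sub>0_def)
  moreover have "transforms L quotient_program (\<lambda>_. 0) A\<^sub>3 A\<^sub>4"
    unfolding A\<^sub>4_def
    by (rule transforms_quotient_program) (use nz in \<open>simp_all add: A\<^sub>3_def A\<^sub>2_def\<close>)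
  ultimately have "transforms L quotients_from_inverse (\<lambda>_. 0) A\<^sub>2 A\<^sub>4"
    unfolding quotients_from_inverse_def by (rule transforms_Seq)
  then obtain n where post: "exec L quotients_from_inverse (\<lambda>_. 0) (A\<^sub>2, m) = Some (A\<^sub>4, n)"
    unfolding transforms_def by blast
  have "mat_of_array L (A\<^sub>1 1) = cut_matrix L S"
    by (rule eq_matI) (simp_all add: mat_of_array_def A\<^sub>1_def cut_matrix_def)
  then have "run_with_inversion L cut_program quotients_from_inverse S = Some (mat_of_array L (A\<^sub>4 3), n)"
    using prep inverse post by (simp add: run_with_inversion_def A\<^sub>0_def[symmetric] A\<^sub>2_def)
  moreover have "n \<le> max_operations L cut_program + max_operations L quotients_from_inverse"
    using exec_operations_le[OF prep] exec_operations_le[OF post] by simp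
  moreover have "mat_of_array L (A\<^sub>4 3) $$ (i, j) = Q S i j" if ij: "i < L" "j < L" "i \<noteq> j" for i j
  proof -
    have "prob_first_entry S i j i = Q_numerator L S B i j / Q_denominator L S B i j"
      using prob_first_entry_first_step[OF sub] S ij
      by (intro first_step_solution_eq_quotient[OF L S B right left irr sub ij]) auto
    then show ?thesis
      using ij by (simp add: mat_of_array_def A\<^sub>4_def Q_eq_prob_first_entry)
  qed
  ultimately show thesis
    using that by blast
qed

theorem theorem5:
  shows "\<exists>(prep :: com) (post :: com) (C :: real). \<forall>(L :: nat) (S :: real mat).
    1 \<le> L \<longrightarrow> S \<in> carrier_mat L L \<longrightarrow> irreducible_matrix S \<longrightarrow> substochastic S \<longrightarrow>
    (\<exists>R n. run_with_inversion L prep post S = Some (R, n) \<and>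
       real n \<le> C * (real L)\<^sup>2 \<and>
       (\<forall>i<L. \<forall>j<L. i \<noteq> j \<longrightarrow> R $$ (i, j) = Q S i j))"
proof (rule exI[of _ cut_program], rule exI[of _ quotients_from_inverse],
    rule exI[of _ "real (max_operations 1 cut_program + max_operations 1 quotients_from_inverse)"],
    intro allI impI)
  fix L S
  assume "1 \<le> L" "S \<in> carrier_mat L L" "irreducible_matrix S" "substochastic S"
  then obtain R n where "run_with_inversion L cut_program quotients_from_inverse S = Some (R, n)"
    and n: "n \<le> max_operations L cut_program + max_operations L quotients_from_inverse"
    and "\<And>i j. i < L \<Longrightarrow> j < L \<Longrightarrow> i \<noteq> j \<Longrightarrow> R $$ (i, j) = Q S i j"
    using run_computes_Q by blast
  moreover have "real n \<le>
      real (max_operations 1 cut_program + max_operations 1 quotients_from_inverse) * (real L)\<^sup>2"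
    using n unfolding max_operations_quadratic[of L] by (metis of_nat_le_iff of_nat_mult of_nat_power)
  ultimately show "\<exists>R n. run_with_inversion L cut_program quotients_from_inverse S = Some (R, n) \<and>
      real n \<le> real (max_operations 1 cut_program + max_operations 1 quotients_from_inverse) * (real L)\<^sup>2 \<and>
      (\<forall>i<L. \<forall>j<L. i \<noteq> j \<longrightarrow> R $$ (i, j) = Q S i j)"
    by blast
qed

end
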